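(* Let $\mathcal{H}=\mathcal{H}_1\oplus\mathcal{H}_2$ and let $$\mathcal{A}=\begin{pmatrix}A&B\\C&D\end{pmatrix},\qquad\operatorname{dom}\mathcal{A}=(\operatorname{dom}A\cap\operatorname{dom}C)\oplus(\operatorname{dom}B\cap\operatorname{dom}D),$$ be a densely defined operator matrix in $\mathcal{H}$ with densely defined closable entries and $C\subseteq B^*$. Assume that there exist $\alpha,\delta\in\mathbb{R}$ and semi-angles $\varphi,\psi\in[0,\pi/2]$ with $$\operatorname{Re}W(D)\le\delta<0<\alpha\le\operatorname{Re}W(A),\qquad W(A)\subseteq\Sigma_\varphi,\qquad W(D)\subseteq-\Sigma_\psi.$$ Suppose further that one of the following holds: (i) $A$, $-D$ are m-accretive, $C$ is $A$-bounded, $B$ is $D$-bounded; (ii) $A$, $-D$ are m-accretive, $A$ is $C$-bounded, $D$ is $B$-bounded and $B$, $C$ are boundedly invertible; (iii) $-D$ is m-sectorial with vertex $0$, i.e. $\psi<\pi/2$, and $B$ is $D$-bounded; (iv) $A$ is m-sectorial with vertex $0$, i.e. $\varphi<\pi/2$, and $C$ is $A$-bounded. Then, with $\tau:=\max\{\varphi,\psi\}$, $$\sigma_{\mathrm{ap}}(\mathcal{A})\subseteq(-\Sigma_\tau\cup\Sigma_\tau)\cap\{z\in\mathbb{C}:\operatorname{Re}z\notin(\delta,\alpha)\}=:\Sigma;$$ if, in addition, $\rho(\mathcal{A})\cap(\mathbb{C}\setminus\Sigma)\ne\emptyset$, then $\sigma(\mathcal{A})\subseteq\Sigma$.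
   Context: $\mathcal{H}_1,\mathcal{H}_2$ are complex Hilbert spaces; $A$ acts in $\mathcal{H}_1$, $D$ in $\mathcal{H}_2$, $B$ from $\mathcal{H}_2$ to $\mathcal{H}_1$, $C$ from $\mathcal{H}_1$ to $\mathcal{H}_2$. $W(T)=\{(Tf,f):f\in\operatorname{dom}T,\|f\|=1\}$ is the numerical range; inequalities such as $\operatorname{Re}W(D)\le\delta$ are meant for all elements of the set. $\Sigma_\omega=\{z\in\mathbb{C}:|\arg z|\le\omega\}$ for $\omega\in[0,\pi/2]$, with $\arg:\mathbb{C}\to(-\pi,\pi]$ and $\arg0=0$. $T$ is m-accretive if $\operatorname{Re}W(T)\ge0$ and $\rho(T)$ contains a point with negative real part (equivalently $\{\operatorname{Re}z<0\}\subseteq\rho(T)$); $T$ is m-sectorial with vertex $0$ and semi-angle $\omega\in[0,\pi/2)$ if $W(T)\subseteq\Sigma_\omega$ and $\rho(T)\cap(\mathbb{C}\setminus\Sigma_\omega)\ne\emptyset$. In (iii) (resp. (iv)) the semi-angle of $-D$ (resp. $A$) is the given $\psi$ (resp. $\varphi$). $S$ is $T$-bounded if $\operatorname{dom}T\subseteq\operatorname{dom}S$ and there are $a,b\ge0$ with $\|Sx\|\le a\|x\|+b\|Tx\|$, $x\in\operatorname{dom}T$. "Boundedly invertible" means bijective from the domain onto the target space with bounded inverse. $\sigma_{\mathrm{ap}}(\mathcal{A})$ is the approximate point spectrum: all $\lambda\in\mathbb{C}$ for which there are $f_n\in\operatorname{dom}\mathcal{A}$, $\|f_n\|=1$, with $(\mathcal{A}-\lambda)f_n\to0$.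 *)

theory Defs
  imports "HOL-Analysis.Analysis"
begin

section \<open>Complex Hilbert spaces\<close>

text \<open>
  The real structure (norm, topology, completeness) is the one of \<^class>\<open>real_inner\<close> and
  \<^class>\<open>banach\<close>; the complex inner product is linear in its first argument and has the real
  inner product as its real part, so that its diagonal is the square of the norm.
\<close>

class chilbert_space = real_inner + banach +
  fixes scaleC :: "complex \<Rightarrow> 'a \<Rightarrow> 'a" (infixr \<open>*\<^sub>C\<close> 75)
    and cinner :: "'a \<Rightarrow> 'a \<Rightarrow> complex"
  assumes scaleC_add_right: "a *\<^sub>C (x + y) = a *\<^sub>C x + a *\<^sub>C y"
    and scaleC_add_left: "(a + b) *\<^sub>C x = a *\<^sub>C x + b *\<^sub>C x"
    and scaleC_scaleC: "a *\<^sub>C b *\<^sub>C x = (a * b) *\<^sub>C x"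
    and scaleC_of_real: "complex_of_real r *\<^sub>C x = r *\<^sub>R x"
    and cinner_commute: "cinner x y = cnj (cinner y x)"
    and cinner_add_left: "cinner (x + y) z = cinner x z + cinner y z"
    and cinner_scaleC_left: "cinner (a *\<^sub>C x) y = a * cinner x y"
    and Re_cinner: "Re (cinner x y) = inner x y"

lemma cinner_self: "cinner x x = complex_of_real ((norm x)\<^sup>2)"
proof (rule complex_eqI)
  show "Re (cinner x x) = Re (complex_of_real ((norm x)\<^sup>2))"
    by (simp add: Re_cinner power2_norm_eq_inner)
  have "Im (cinner x x) = Im (cnj (cinner x x))"
    using cinner_commute[of x x] by simp
  then show "Im (cinner x x) = Im (complex_of_real ((norm x)\<^sup>2))"
    by simp
qed

instantiation complex :: chilbert_space
begin

definition scaleC_complex :: "complex \<Rightarrow> complex \<Rightarrow> complex"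
  where "scaleC_complex a x = a * x"

definition cinner_complex :: "complex \<Rightarrow> complex \<Rightarrow> complex"
  where "cinner_complex x y = x * cnj y"

instance
  by standard
    (simp_all add: scaleC_complex_def cinner_complex_def algebra_simps scaleR_conv_of_real
      inner_complex_def)

end

text \<open>The orthogonal sum of two Hilbert spaces is their product; its library norm is
  \<open>norm (x, y) = sqrt ((norm x)\<^sup>2 + (norm y)\<^sup>2)\<close>.\<close>

instantiation prod :: (chilbert_space, chilbert_space) chilbert_space
begin

definition scaleC_prod :: "complex \<Rightarrow> 'a \<times> 'b \<Rightarrow> 'a \<times> 'b"
  where "scaleC_prod a p = (a *\<^sub>C fst p, a *\<^sub>C snd p)"

definition cinner_prod :: "'a \<times> 'b \<Rightarrow> 'a \<times> 'b \<Rightarrow> complex"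
  where "cinner_prod p q = cinner (fst p) (fst q) + cinner (snd p) (snd q)"

instance
proof
  fix p q r :: "'a \<times> 'b" and a b :: complex and t :: real
  show "a *\<^sub>C (p + q) = a *\<^sub>C p + a *\<^sub>C q"
    by (simp add: scaleC_prod_def scaleC_add_right)
  show "(a + b) *\<^sub>C p = a *\<^sub>C p + b *\<^sub>C p"
    by (simp add: scaleC_prod_def scaleC_add_left)
  show "a *\<^sub>C b *\<^sub>C p = (a * b) *\<^sub>C p"
    by (simp add: scaleC_prod_def scaleC_scaleC)
  show "complex_of_real t *\<^sub>C p = t *\<^sub>R p"
    by (simp add: scaleC_prod_def scaleC_of_real scaleR_prod_def)
  show "cinner p q = cnj (cinner q p)"
    using cinner_commute[of "fst p" "fst q"] cinner_commute[of "snd p" "snd q"]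
    by (simp add: cinner_prod_def)
  show "cinner (p + q) r = cinner p r + cinner q r"
    by (simp add: cinner_prod_def cinner_add_left)
  show "cinner (a *\<^sub>C p) q = a * cinner p q"
    by (simp add: cinner_prod_def scaleC_prod_def cinner_scaleC_left distrib_left)
  show "Re (cinner p q) = inner p q"
    by (simp add: cinner_prod_def Re_cinner inner_prod_def)
qed

end


section \<open>Unbounded linear operators\<close>

text \<open>
  An operator is a domain together with a total function. The values of the function outside the
  domain carry no meaning and are ignored by all notions below; in particular operators should be
  compared with \<open>op_subset\<close> and not with \<open>=\<close>.
\<close>

datatype ('a, 'b) unb_op = Unb_Op (op_dom: "'a set") (op_app: "'a \<Rightarrow> 'b")

definition linear_op :: "('a::chilbert_space, 'b::chilbert_space) unb_op \<Rightarrow> bool"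
  where "linear_op T \<longleftrightarrow>
    0 \<in> op_dom T \<and>
    (\<forall>x\<in>op_dom T. \<forall>y\<in>op_dom T. x + y \<in> op_dom T \<and> op_app T (x + y) = op_app T x + op_app T y) \<and>
    (\<forall>c. \<forall>x\<in>op_dom T. c *\<^sub>C x \<in> op_dom T \<and> op_app T (c *\<^sub>C x) = c *\<^sub>C op_app T x)"

definition op_graph :: "('a, 'b) unb_op \<Rightarrow> ('a \<times> 'b) set"
  where "op_graph T = {(x, op_app T x) | x. x \<in> op_dom T}"

definition op_subset :: "('a, 'b) unb_op \<Rightarrow> ('a, 'b) unb_op \<Rightarrow> bool"  (infix \<open>\<subseteq>\<^sub>o\<close> 50)
  where "S \<subseteq>\<^sub>o T \<longleftrightarrow> op_dom S \<subseteq> op_dom T \<and> (\<forall>x\<in>op_dom S. op_app S x = op_app T x)"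

definition densely_defined :: "('a::chilbert_space, 'b) unb_op \<Rightarrow> bool"
  where "densely_defined T \<longleftrightarrow> closure (op_dom T) = UNIV"

definition closed_op :: "('a::chilbert_space, 'b::chilbert_space) unb_op \<Rightarrow> bool"
  where "closed_op T \<longleftrightarrow> linear_op T \<and> closed (op_graph T)"

definition closable_op :: "('a::chilbert_space, 'b::chilbert_space) unb_op \<Rightarrow> bool"
  where "closable_op T \<longleftrightarrow> (\<exists>S. closed_op S \<and> T \<subseteq>\<^sub>o S)"

text \<open>The vector \<open>z\<close> below is unique when \<open>T\<close> is densely defined, the only case in which the
  adjoint is meaningful.\<close>

definition op_adjoint :: "('a::chilbert_space, 'b::chilbert_space) unb_op \<Rightarrow> ('b, 'a) unb_op"
  where "op_adjoint T = Unb_Op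
    {y. \<exists>z. \<forall>x\<in>op_dom T. cinner (op_app T x) y = cinner x z}
    (\<lambda>y. THE z. \<forall>x\<in>op_dom T. cinner (op_app T x) y = cinner x z)"

definition op_uminus :: "('a, 'b::chilbert_space) unb_op \<Rightarrow> ('a, 'b) unb_op"
  where "op_uminus T = Unb_Op (op_dom T) (\<lambda>x. - op_app T x)"

definition op_shift :: "('a::chilbert_space, 'a) unb_op \<Rightarrow> complex \<Rightarrow> ('a, 'a) unb_op"
  where "op_shift T z = Unb_Op (op_dom T) (\<lambda>x. op_app T x - z *\<^sub>C x)"

definition rel_bounded ::
  "('a::chilbert_space, 'b::chilbert_space) unb_op \<Rightarrow> ('a, 'c::chilbert_space) unb_op \<Rightarrow> bool"
  where "rel_bounded S T \<longleftrightarrow> op_dom T \<subseteq> op_dom S \<and>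
    (\<exists>a b. 0 \<le> a \<and> 0 \<le> b \<and>
      (\<forall>x\<in>op_dom T. norm (op_app S x) \<le> a * norm x + b * norm (op_app T x)))"

definition boundedly_invertible :: "('a::chilbert_space, 'b::chilbert_space) unb_op \<Rightarrow> bool"
  where "boundedly_invertible T \<longleftrightarrow> bij_betw (op_app T) (op_dom T) UNIV \<and>
    (\<exists>c. \<forall>y. norm (inv_into (op_dom T) (op_app T) y) \<le> c * norm y)"

definition resolvent_set :: "('a::chilbert_space, 'a) unb_op \<Rightarrow> complex set"
  where "resolvent_set T = {z. boundedly_invertible (op_shift T z)}"

definition op_spectrum :: "('a::chilbert_space, 'a) unb_op \<Rightarrow> complex set"
  where "op_spectrum T = - resolvent_set T"

definition approx_point_spectrum :: "('a::chilbert_space, 'a) unb_op \<Rightarrow> complex set"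
  where "approx_point_spectrum T = {z. \<exists>f::nat \<Rightarrow> 'a.
    (\<forall>n. f n \<in> op_dom T \<and> norm (f n) = 1) \<and>
    (\<lambda>n. op_app (op_shift T z) (f n)) \<longlonglongrightarrow> 0}"

definition numerical_range :: "('a::chilbert_space, 'a) unb_op \<Rightarrow> complex set"
  where "numerical_range T = {cinner (op_app T f) f | f. f \<in> op_dom T \<and> norm f = 1}"

text \<open>\<^const>\<open>Arg\<close> takes values in \<open>(-\<pi>, \<pi>]\<close> and \<open>Arg 0 = 0\<close>.\<close>

definition sector :: "real \<Rightarrow> complex set"
  where "sector \<omega> = {z. \<bar>Arg z\<bar> \<le> \<omega>}"

definition m_accretive :: "('a::chilbert_space, 'a) unb_op \<Rightarrow> bool"
  where "m_accretive T \<longleftrightarrow>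
    (\<forall>z\<in>numerical_range T. 0 \<le> Re z) \<and> (\<exists>z\<in>resolvent_set T. Re z < 0)"

text \<open>The vertex is \<open>0\<close>.\<close>

definition m_sectorial :: "('a::chilbert_space, 'a) unb_op \<Rightarrow> real \<Rightarrow> bool"
  where "m_sectorial T \<omega> \<longleftrightarrow> 0 \<le> \<omega> \<and> \<omega> < pi / 2 \<and>
    numerical_range T \<subseteq> sector \<omega> \<and> resolvent_set T \<inter> - sector \<omega> \<noteq> {}"

definition block_op ::
  "('a::chilbert_space, 'a) unb_op \<Rightarrow> ('b::chilbert_space, 'a) unb_op \<Rightarrow>
   ('a, 'b) unb_op \<Rightarrow> ('b, 'b) unb_op \<Rightarrow> ('a \<times> 'b, 'a \<times> 'b) unb_op"
  where "block_op A B C D = Unb_Op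
    ((op_dom A \<inter> op_dom C) \<times> (op_dom B \<inter> op_dom D))
    (\<lambda>(f, g). (op_app A f + op_app B g, op_app C f + op_app D g))"

end

(*
  For (f, g) in the domain put (h, k) = (\<A> - \<lambda>)(f, g). Since C is contained in B*, the coupling terms
  (Bg, f) and (Cf, g) are conjugate, so they cancel in (h, f) - conj (k, g), which equals
  (Af, f) - conj (Dg, g) - \<lambda> |f|^2 + conj \<lambda> |g|^2. Along an approximate eigensequence this tends to 0.
  The real part excludes \<delta> < Re \<lambda> < \<alpha>; combined with the imaginary part it gives
  |Im \<lambda>| cos \<tau> \<le> |Re \<lambda>| sin \<tau>. Off the approximate point spectrum the resolvent set is relatively
  open and closed, and the complement of \<Sigma> is star-shaped about 0, hence connected.
*)
theory Submission
  imports Defs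
begin

section \<open>Algebra and Cauchy-Schwarz for the complex inner product\<close>

lemma scaleC_uminus_right: "z *\<^sub>C (- x) = - (z *\<^sub>C x)" for x :: "'a::chilbert_space"
proof (rule minus_unique[symmetric])
  have "z *\<^sub>C 0 = (0 :: 'a)"
    using scaleC_add_right[of z "0 :: 'a" 0] by simp
  then show "z *\<^sub>C x + z *\<^sub>C (- x) = 0"
    by (simp flip: scaleC_add_right)
qed

lemma scaleC_diff_right: "z *\<^sub>C (x - y) = z *\<^sub>C x - z *\<^sub>C y" for x :: "'a::chilbert_space"
  using scaleC_add_right[of z x "- y"] by (simp add: scaleC_uminus_right)

lemma scaleC_diff_left: "(z - w) *\<^sub>C x = z *\<^sub>C x - w *\<^sub>C x" for x :: "'a::chilbert_space"
  using scaleC_add_left[of "z - w" w x] by (simp add: algebra_simps)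

lemma cinner_zero_left: "cinner 0 x = 0"
  using cinner_add_left[of 0 0 x] by simp

lemma cinner_zero_right: "cinner x 0 = 0"
  using cinner_commute[of x 0] by (simp add: cinner_zero_left)

lemma cinner_diff_left: "cinner (x - y) z = cinner x z - cinner y z"
  using cinner_add_left[of "x - y" y z] by simp

lemma cinner_add_right: "cinner x (y + z) = cinner x y + cinner x z"
  using cinner_commute[of x "y + z"] cinner_commute[of x y] cinner_commute[of x z]
  by (simp add: cinner_add_left)

lemma cinner_diff_right: "cinner x (y - z) = cinner x y - cinner x z"
  using cinner_add_right[of x "y - z" z] by simp

lemma cinner_scaleC_right: "cinner x (z *\<^sub>C y) = cnj z * cinner x y"
  using cinner_commute[of x "z *\<^sub>C y"] cinner_commute[of x y]
  by (simp add: cinner_scaleC_left)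

text \<open>The class postulates homogeneity of the norm for real scalars only; for complex ones it
  follows from sesquilinearity and \<open>cinner_self\<close>.\<close>

lemma norm_scaleC: "norm (z *\<^sub>C x) = cmod z * norm x" for x :: "'a::chilbert_space"
proof -
  have "complex_of_real ((norm (z *\<^sub>C x))\<^sup>2) = (z * cnj z) * cinner x x"
    unfolding cinner_self[symmetric] by (simp add: cinner_scaleC_left cinner_scaleC_right)
  also have "\<dots> = complex_of_real ((cmod z * norm x)\<^sup>2)"
    by (simp add: cinner_self complex_norm_square[symmetric] power_mult_distrib)
  finally have "(norm (z *\<^sub>C x))\<^sup>2 = (cmod z * norm x)\<^sup>2"
    by (simp only: of_real_eq_iff)
  then show ?thesis
    by (simp add: power2_eq_iff_nonneg)
qed

text \<open>Multiplying \<open>x\<close> by a unimodular \<open>u\<close> rotates the inner product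
  onto its modulus, so the Cauchy-Schwarz inequality of the real structure applies.\<close>

lemma cmod_cinner_le: "cmod (cinner x y) \<le> norm x * norm y"
proof (cases "cinner x y = 0")
  case False
  define u where "u = cnj (sgn (cinner x y))"
  have u: "cmod u = 1"
    using False by (simp add: u_def norm_sgn)
  have "u * cinner x y = cmod (cinner x y)"
    using False complex_norm_square[of "cinner x y"]
    by (simp add: u_def sgn_div_norm scaleR_conv_of_real field_simps power2_eq_square)
  then have "cmod (cinner x y) = inner (u *\<^sub>C x) y"
    by (metis Re_complex_of_real Re_cinner cinner_scaleC_left)
  also have "\<dots> \<le> norm (u *\<^sub>C x) * norm y"
    by (rule norm_cauchy_schwarz)
  finally show ?thesis
    by (simp add: norm_scaleC u)
qed simp

section \<open>Sectors as trigonometric inequalities\<close>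

lemma sector_eq:
  assumes "\<omega> \<in> {0..pi / 2}"
  shows "sector \<omega> = {z. 0 \<le> Re z \<and> \<bar>Im z\<bar> * cos \<omega> \<le> Re z * sin \<omega>}"
proof -
  \<comment> \<open>For nonzero \<open>z\<close> the polar form turns the second condition into
    sin(\<omega> - \<theta>) >= 0 with \<theta> = |Arg z|, and the first one confines \<theta> to
    [0, \<pi>/2]. Avoiding the tangent lets \<omega> = \<pi>/2 be included.\<close>
  have "\<bar>Arg z\<bar> \<le> \<omega> \<longleftrightarrow> 0 \<le> Re z \<and> \<bar>Im z\<bar> * cos \<omega> \<le> Re z * sin \<omega>" for z
  proof (cases "z = 0")
    case True
    then show ?thesis using assms by (simp add: Arg_zero)
  next
    case False
    define \<theta> where "\<theta> = \<bar>Arg z\<bar>"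
    have \<theta>: "0 \<le> \<theta>" "\<theta> \<le> pi"
      using Arg_bounded[of z] by (auto simp: \<theta>_def)
    have z: "z = cmod z * cis (Arg z)"
      using rcis_cmod_Arg[of z] by (simp add: rcis_def)
    have Re: "Re z = cmod z * cos \<theta>"
      by (subst z) (simp add: \<theta>_def)
    have "\<bar>Im z\<bar> = cmod z * \<bar>sin (Arg z)\<bar>"
      by (subst z) (simp add: abs_mult)
    also have "\<bar>sin (Arg z)\<bar> = \<bar>sin \<theta>\<bar>"
      by (simp add: \<theta>_def abs_if)
    also have "\<bar>sin \<theta>\<bar> = sin \<theta>"
      using \<theta> by (simp add: sin_ge_zero)
    finally have Im: "\<bar>Im z\<bar> = cmod z * sin \<theta>" .
    have r: "0 < cmod z"
      using False by simp
    have Re_iff: "0 \<le> Re z \<longleftrightarrow> 0 \<le> cos \<theta>"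
      using r by (simp add: Re zero_le_mult_iff)
    have "Re z * sin \<omega> - \<bar>Im z\<bar> * cos \<omega> = cmod z * sin (\<omega> - \<theta>)"
      by (simp add: Re Im sin_diff algebra_simps)
    then have Im_iff: "\<bar>Im z\<bar> * cos \<omega> \<le> Re z * sin \<omega> \<longleftrightarrow> 0 \<le> sin (\<omega> - \<theta>)"
      using r by (metis diff_ge_0_iff_ge zero_le_mult_iff less_imp_le not_less)
    have "\<theta> \<le> \<omega> \<longleftrightarrow> 0 \<le> cos \<theta> \<and> 0 \<le> sin (\<omega> - \<theta>)"
    proof
      assume "\<theta> \<le> \<omega>"
      then show "0 \<le> cos \<theta> \<and> 0 \<le> sin (\<omega> - \<theta>)"
        using assms \<theta> by (auto intro!: cos_ge_zero sin_ge_zero)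
    next
      assume *: "0 \<le> cos \<theta> \<and> 0 \<le> sin (\<omega> - \<theta>)"
      show "\<theta> \<le> \<omega>"
      proof (rule ccontr)
        assume "\<not> \<theta> \<le> \<omega>"
        moreover have "\<theta> \<le> pi / 2"
          using * \<theta> cos_lt_zero_pi[of \<theta>] by force
        ultimately have "0 < sin (\<theta> - \<omega>)"
          using assms by (intro sin_gt_zero) auto
        then show False
          using * sin_minus[of "\<theta> - \<omega>"] by simp
      qed
    qed
    then show ?thesis
      unfolding \<theta>_def[symmetric] by (simp only: Re_iff Im_iff)
  qed
  then show ?thesis
    by (simp add: sector_def)
qed

lemma sector_mono: "\<omega> \<le> \<tau> \<Longrightarrow> sector \<omega> \<subseteq> sector \<tau>"
  by (auto simp: sector_def)

text \<open>The sign of \<open>Re z\<close> decides which of the two sectors is relevant; on the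
  imaginary axis their conditions coincide.\<close>

lemma double_sector_eq:
  assumes "\<omega> \<in> {0..pi / 2}"
  shows "uminus ` sector \<omega> \<union> sector \<omega> = {z. \<bar>Im z\<bar> * cos \<omega> \<le> \<bar>Re z\<bar> * sin \<omega>}"
proof -
  have "z \<in> uminus ` sector \<omega> \<longleftrightarrow> - z \<in> sector \<omega>" for z
    by force
  moreover have "- z \<in> sector \<omega> \<or> z \<in> sector \<omega> \<longleftrightarrow> \<bar>Im z\<bar> * cos \<omega> \<le> \<bar>Re z\<bar> * sin \<omega>" for z
    by (cases "Re z" "0 :: real" rule: linorder_cases) (simp_all add: sector_eq[OF assms])
  ultimately show ?thesis
    by blast
qed

section \<open>Numerical ranges, adjoints and linearity\<close>

lemma numerical_range_cinner:
  assumes "linear_op T" "f \<in> op_dom T"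
  obtains "f = 0" | z where "z \<in> numerical_range T"
    "cinner (op_app T f) f = complex_of_real ((norm f)\<^sup>2) * z"
proof (cases "f = 0")
  case False
  \<comment> \<open>Normalising \<open>f\<close> reaches a unit vector; the quadratic form is
    homogeneous of degree two, which produces the factor |f|^2. The zero vector is kept apart
    because the numerical range may be empty.\<close>
  define c where "c = complex_of_real (inverse (norm f))"
  have c: "cnj c * (c * complex_of_real ((norm f)\<^sup>2)) = 1"
    using False by (simp add: c_def power2_eq_square field_simps)
  have dom: "c *\<^sub>C f \<in> op_dom T" "op_app T (c *\<^sub>C f) = c *\<^sub>C op_app T f"
    using assms by (auto simp: linear_op_def)
  have "norm (c *\<^sub>C f) = 1"
    using False by (simp add: norm_scaleC c_def norm_inverse)
  then have "cinner (op_app T (c *\<^sub>C f)) (c *\<^sub>C f) \<in> numerical_range T"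
    using dom(1) unfolding numerical_range_def by blast
  moreover have "cinner (op_app T f) f
      = complex_of_real ((norm f)\<^sup>2) * cinner (op_app T (c *\<^sub>C f)) (c *\<^sub>C f)"
    using c by (simp add: dom cinner_scaleC_left cinner_scaleC_right algebra_simps)
  ultimately show thesis
    using that(2) by blast
qed

text \<open>The adjoint takes its value by \<open>THE\<close>, so uniqueness must come first: two
  candidates differ by a vector orthogonal to the domain, hence to its closure, which is everything,
  hence to itself.\<close>

lemma op_adjoint_cinner:
  assumes "densely_defined T" "y \<in> op_dom (op_adjoint T)" "x \<in> op_dom T"
  shows "cinner (op_app T x) y = cinner x (op_app (op_adjoint T) y)"
proof -
  let ?P = "\<lambda>z. \<forall>x\<in>op_dom T. cinner (op_app T x) y = cinner x z"
  obtain z where z: "?P z"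
    using assms(2) by (auto simp: op_adjoint_def)
  have "w = z" if w: "?P w" for w
  proof -
    have "op_dom T \<subseteq> {x. inner x (w - z) = 0}"
      using w z by (auto simp flip: Re_cinner simp: cinner_diff_right)
    moreover have "closed {x. inner x (w - z) = 0}"
      by (intro closed_Collect_eq continuous_intros)
    ultimately have "closure (op_dom T) \<subseteq> {x. inner x (w - z) = 0}"
      by (rule closure_minimal)
    then have "inner (w - z) (w - z) = 0"
      using assms(1) unfolding densely_defined_def by blast
    then show "w = z" by simp
  qed
  with z have "?P (THE z. ?P z)"
    by (rule theI)
  with assms(3) show ?thesis
    by (simp add: op_adjoint_def)
qed

lemma linear_op_block_op:
  assumes "linear_op A" "linear_op B" "linear_op C" "linear_op D"
  shows "linear_op (block_op A B C D)"
  using assms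
  by (auto simp: linear_op_def block_op_def scaleC_prod_def scaleC_add_right zero_prod_def)

section \<open>Bounds from below, approximate point spectrum and resolvent set\<close>

lemma op_app_op_shift_diff:
  assumes "linear_op T" "x \<in> op_dom T" "y \<in> op_dom T"
  shows "x - y \<in> op_dom T"
    and "op_app (op_shift T z) (x - y) = op_app (op_shift T z) x - op_app (op_shift T z) y"
proof -
  have m: "- y = (- 1) *\<^sub>C y" "- op_app T y = (- 1) *\<^sub>C op_app T y"
    using scaleC_of_real[of "- 1" y] scaleC_of_real[of "- 1" "op_app T y"] by simp_all
  have "(- 1) *\<^sub>C y \<in> op_dom T" "op_app T ((- 1) *\<^sub>C y) = (- 1) *\<^sub>C op_app T y"
    using assms by (auto simp: linear_op_def)
  then have y: "- y \<in> op_dom T" "op_app T (- y) = - op_app T y"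
    by (simp_all add: m)
  with assms have "x + (- y) \<in> op_dom T" "op_app T (x + (- y)) = op_app T x + op_app T (- y)"
    by (auto simp: linear_op_def)
  with y show "x - y \<in> op_dom T"
    and "op_app (op_shift T z) (x - y) = op_app (op_shift T z) x - op_app (op_shift T z) y"
    by (simp_all add: op_shift_def scaleC_diff_right)
qed

text \<open>Positivity of \<open>c\<close> is built in so that mere existence of \<open>c\<close> is
  a meaningful condition. The constant is kept explicit because it controls how far the spectral
  parameter may move.\<close>

definition bounded_below_op :: "real \<Rightarrow> ('a::chilbert_space, 'b::chilbert_space) unb_op \<Rightarrow> bool"
  where "bounded_below_op c T \<longleftrightarrow> 0 < c \<and> (\<forall>x\<in>op_dom T. c * norm x \<le> norm (op_app T x))"

lemma op_dom_op_shift [simp]: "op_dom (op_shift T z) = op_dom T"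
  by (simp add: op_shift_def)

lemma op_app_op_shift_change:
  "op_app (op_shift T w) x = op_app (op_shift T z) x - (w - z) *\<^sub>C x"
  by (simp add: op_shift_def scaleC_diff_left)

text \<open>By the triangle inequality, moving the shift from \<open>z\<close> to \<open>w\<close>
  costs at most |w - z| of the constant.\<close>

lemma bounded_below_op_shift_change:
  assumes "bounded_below_op c (op_shift T z)" "cmod (w - z) < c"
  shows "bounded_below_op (c - cmod (w - z)) (op_shift T w)"
proof -
  have "(c - cmod (w - z)) * norm x \<le> norm (op_app (op_shift T w) x)" if "x \<in> op_dom T" for x
  proof -
    have "c * norm x \<le> norm (op_app (op_shift T z) x)"
      using assms that by (auto simp: bounded_below_op_def)
    also have "\<dots> \<le> norm (op_app (op_shift T w) x) + norm ((w - z) *\<^sub>C x)"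
      unfolding op_app_op_shift_change[of T w x z]
      using norm_triangle_ineq[of "op_app (op_shift T z) x - (w - z) *\<^sub>C x" "(w - z) *\<^sub>C x"]
      by simp
    finally show ?thesis
      by (simp add: norm_scaleC algebra_simps)
  qed
  with assms show ?thesis
    by (simp add: bounded_below_op_def)
qed

text \<open>If no constant works, then each 1/(n+1) fails, and the normalised witnesses of these
  failures form an approximate eigensequence.\<close>

lemma bounded_below_op_if_not_approx_point_spectrum:
  assumes "linear_op T" "z \<notin> approx_point_spectrum T"
  shows "\<exists>c. bounded_below_op c (op_shift T z)"
proof (rule ccontr)
  let ?S = "op_shift T z"
  assume contr: "\<nexists>c. bounded_below_op c ?S"
  have "\<exists>x\<in>op_dom T. norm x = 1 \<and> norm (op_app ?S x) < inverse (real (Suc n))" for n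
  proof -
    obtain x where x: "x \<in> op_dom T"
      "norm (op_app ?S x) < inverse (real (Suc n)) * norm x"
    proof -
      have "\<not> bounded_below_op (inverse (real (Suc n))) ?S"
        using contr by blast
      then show thesis
        using that by (auto simp: bounded_below_op_def not_le simp del: of_nat_Suc)
    qed
    have "x \<noteq> 0"
      using x(2) by auto
    then have x0: "norm x > 0"
      by simp
    define c where "c = complex_of_real (inverse (norm x))"
    have cx: "c *\<^sub>C x \<in> op_dom T" "op_app T (c *\<^sub>C x) = c *\<^sub>C op_app T x"
      using assms(1) x by (auto simp: linear_op_def)
    have "z *\<^sub>C c *\<^sub>C x = c *\<^sub>C z *\<^sub>C x"
      by (simp add: scaleC_scaleC mult.commute)
    then have "op_app ?S (c *\<^sub>C x) = c *\<^sub>C op_app ?S x"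
      by (simp add: op_shift_def cx scaleC_diff_right)
    then have "norm (op_app ?S (c *\<^sub>C x)) = inverse (norm x) * norm (op_app ?S x)"
      by (simp add: norm_scaleC c_def norm_inverse)
    also have "\<dots> < inverse (real (Suc n))"
      using x x0 by (simp add: field_simps)
    finally show ?thesis
      using cx x0 by (intro bexI[of _ "c *\<^sub>C x"]) (auto simp: norm_scaleC c_def norm_inverse)
  qed
  then obtain f where f: "\<And>n. f n \<in> op_dom T" "\<And>n. norm (f n) = 1"
    "\<And>n. norm (op_app ?S (f n)) < inverse (real (Suc n))"
    by metis
  have "(\<lambda>n. op_app ?S (f n)) \<longlonglongrightarrow> 0"
    using f(3) less_imp_le
    by (intro Lim_null_comparison[OF always_eventually LIMSEQ_inverse_real_of_nat]) blast
  with f assms(2) show False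
    unfolding approx_point_spectrum_def by blast
qed

text \<open>A Neumann series argument: solving \<open>(T - w) x = y\<close> means finding the fixed point of
  \<open>x \<mapsto> (T - z)\<^sup>-\<^sup>1 (y + (w - z) x)\<close>.\<close>

lemma resolvent_set_near:
  assumes "linear_op T" "z \<in> resolvent_set T" "bounded_below_op c (op_shift T z)"
    and "cmod (w - z) < c"
  shows "w \<in> resolvent_set T"
proof -
  let ?S = "op_shift T z" and ?R = "op_shift T w"
  let ?inv = "inv_into (op_dom T) (op_app ?S)"
  let ?d = "c - cmod (w - z)"
  have bij: "bij_betw (op_app ?S) (op_dom T) UNIV"
    using assms(2) by (simp add: resolvent_set_def boundedly_invertible_def)
  have inv_dom: "?inv y \<in> op_dom T" and inv_app: "op_app ?S (?inv y) = y" for y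
    using bij by (auto simp: bij_betw_def inv_into_into f_inv_into_f)
  have c: "0 < c" and below: "\<And>x. x \<in> op_dom T \<Longrightarrow> c * norm x \<le> norm (op_app ?S x)"
    using assms(3) by (auto simp: bounded_below_op_def)
  \<comment> \<open>The lower bound makes the inverse Lipschitz with constant 1/c; this is why |w -
    z| < c suffices for the contraction below.\<close>
  have inv_dist: "norm (?inv y - ?inv y') \<le> norm (y - y') / c" for y y'
    using below[OF op_app_op_shift_diff(1)[OF assms(1) inv_dom[of y] inv_dom[of y']]] c
    by (simp add: op_app_op_shift_diff(2)[OF assms(1) inv_dom inv_dom] inv_app field_simps)
  have belowR: "0 < ?d" "\<And>x. x \<in> op_dom T \<Longrightarrow> ?d * norm x \<le> norm (op_app ?R x)"
    using bounded_below_op_shift_change[OF assms(3,4)] by (auto simp: bounded_below_op_def)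
  have inj: "inj_on (op_app ?R) (op_dom T)"
  proof (rule inj_onI)
    fix x y assume xy: "x \<in> op_dom T" "y \<in> op_dom T" "op_app ?R x = op_app ?R y"
    then have "?d * norm (x - y) \<le> 0"
      using belowR(2)[OF op_app_op_shift_diff(1)[OF assms(1) xy(1,2)]]
      by (simp add: op_app_op_shift_diff(2)[OF assms(1)])
    with belowR(1) show "x = y"
      by (simp add: mult_le_0_iff)
  qed
  have surj: "\<exists>x\<in>op_dom T. op_app ?R x = y" for y
  proof -
    \<comment> \<open>A fixed point is a value of the inverse, so it lies in the domain
      automatically.\<close>
    define F where "F x = ?inv (y + (w - z) *\<^sub>C x)" for x
    have "dist (F x) (F x') \<le> cmod (w - z) / c * dist x x'" for x x'
      using inv_dist[of "y + (w - z) *\<^sub>C x" "y + (w - z) *\<^sub>C x'"]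
      by (simp add: F_def dist_norm norm_scaleC flip: scaleC_diff_right)
    then have "\<exists>!x. F x = x"
      using c assms(4) by (intro banach_fix_type[where c = "cmod (w - z) / c"]) auto
    then obtain x where x: "F x = x"
      by blast
    then have "x \<in> op_dom T"
      using inv_dom by (metis F_def)
    moreover have "op_app ?S x = y + (w - z) *\<^sub>C x"
      using inv_app by (metis F_def x)
    then have "op_app ?R x = y"
      by (simp add: op_app_op_shift_change[of T w x z])
    ultimately show ?thesis by blast
  qed
  have bijR: "bij_betw (op_app ?R) (op_dom T) UNIV"
    using inj surj unfolding bij_betw_def by (auto simp: set_eq_iff image_iff) metis
  have "norm (inv_into (op_dom T) (op_app ?R) y) \<le> (1 / ?d) * norm y" for y
  proof -
    have "inv_into (op_dom T) (op_app ?R) y \<in> op_dom T"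
      "op_app ?R (inv_into (op_dom T) (op_app ?R) y) = y"
      using bijR by (auto simp: bij_betw_def inv_into_into f_inv_into_f)
    with belowR show ?thesis
      by (metis divide_inverse inverse_eq_divide mult.commute pos_le_divide_eq)
  qed
  with bijR show ?thesis
    unfolding resolvent_set_def boundedly_invertible_def op_dom_op_shift by blast
qed

text \<open>Each point of \<open>U\<close> has a disc lying wholly inside or wholly outside the
  resolvent set, so two disjoint interiors cover \<open>U\<close>; connectedness leaves only the one
  that \<open>U\<close> is known to meet.\<close>

lemma connected_subset_resolvent_set:
  assumes T: "linear_op T" and U: "connected U" "U \<inter> approx_point_spectrum T = {}"
    and meet: "U \<inter> resolvent_set T \<noteq> {}"
  shows "U \<subseteq> resolvent_set T"
proof -
  let ?\<rho> = "resolvent_set T"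
  have "z \<in> interior ?\<rho> \<union> interior (- ?\<rho>)" if "z \<in> U" for z
  proof -
    obtain c where c: "bounded_below_op c (op_shift T z)"
      using bounded_below_op_if_not_approx_point_spectrum[OF T, of z] U(2) \<open>z \<in> U\<close> by blast
    then have "0 < c"
      by (simp add: bounded_below_op_def)
    show ?thesis
    proof (cases "z \<in> ?\<rho>")
      case True
      then have "ball z c \<subseteq> ?\<rho>"
        using resolvent_set_near[OF T _ c] by (auto simp: dist_norm norm_minus_commute)
      with \<open>0 < c\<close> show ?thesis
        by (auto simp: mem_interior)
    next
      case False
      \<comment> \<open>With |w - z| < c/2 the constant remaining at \<open>w\<close> exceeds c/2,
        hence exceeds |z - w|; a resolvent point \<open>w\<close> would therefore force
        \<open>z\<close> into the resolvent set.\<close>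
      have "w \<notin> ?\<rho>" if w: "cmod (w - z) < c / 2" for w
      proof
        assume "w \<in> ?\<rho>"
        moreover have "bounded_below_op (c - cmod (w - z)) (op_shift T w)"
          using w \<open>0 < c\<close> by (intro bounded_below_op_shift_change[OF c]) auto
        ultimately have "z \<in> ?\<rho>"
          using w by (elim resolvent_set_near[OF T]) (auto simp: norm_minus_commute)
        with False show False by simp
      qed
      then have "ball z (c / 2) \<subseteq> - ?\<rho>"
        by (auto simp: dist_norm norm_minus_commute)
      with \<open>0 < c\<close> show ?thesis
        by (auto simp: mem_interior intro!: exI[of _ "c / 2"])
    qed
  qed
  then have sub: "U \<subseteq> interior ?\<rho> \<union> interior (- ?\<rho>)"
    by blast
  have "interior ?\<rho> \<inter> U = {} \<or> interior (- ?\<rho>) \<inter> U = {}"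
    using interior_subset[of ?\<rho>] interior_subset[of "- ?\<rho>"]
    by (intro connectedD[OF U(1) _ _ _ sub]) auto
  moreover have "interior ?\<rho> \<inter> U \<noteq> {}"
    using sub meet interior_subset[of "- ?\<rho>"] by blast
  ultimately have "U \<subseteq> interior ?\<rho>"
    using sub by blast
  then show ?thesis
    using interior_subset by blast
qed

section \<open>Enclosure of the spectrum of the block matrix\<close>

lemma block_op_coupling_cancels:
  fixes A :: "('h1::chilbert_space, 'h1) unb_op" and D :: "('h2::chilbert_space, 'h2) unb_op"
  assumes "densely_defined B" "C \<subseteq>\<^sub>o op_adjoint B" "f \<in> op_dom C" "g \<in> op_dom B"
  shows "cinner (fst (op_app (op_shift (block_op A B C D) z) (f, g))) f
      - cnj (cinner (snd (op_app (op_shift (block_op A B C D) z) (f, g))) g)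
    = cinner (op_app A f) f - cnj (cinner (op_app D g) g)
      - z * complex_of_real ((norm f)\<^sup>2) + cnj z * complex_of_real ((norm g)\<^sup>2)"
proof -
  \<comment> \<open>The inclusion of \<open>C\<close> in the adjoint makes the coupling terms
    conjugate. Conjugating the second component also turns \<open>z\<close> into
    \<open>cnj z\<close>, so |f|^2 and |g|^2 enter with opposite signs in the real part and equal
    signs in the imaginary part.\<close>
  have "cinner (op_app B g) f = cinner g (op_app C f)"
    using assms op_adjoint_cinner[OF assms(1), of f g] by (auto simp: op_subset_def)
  also have "\<dots> = cnj (cinner (op_app C f) g)"
    by (rule cinner_commute)
  finally show ?thesis
    by (simp add: op_shift_def block_op_def scaleC_prod_def cinner_diff_left cinner_add_left
        cinner_scaleC_left cinner_self)
qed

theorem theorem6p1: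
  fixes A :: "('h1::chilbert_space, 'h1) unb_op"
    and B :: "('h2::chilbert_space, 'h1) unb_op"
    and C :: "('h1, 'h2) unb_op"
    and D :: "('h2, 'h2) unb_op"
    and \<alpha> \<delta> \<phi> \<psi> :: real
  assumes "linear_op A" "linear_op B" "linear_op C" "linear_op D"
    and "densely_defined A" "densely_defined B" "densely_defined C" "densely_defined D"
    and "closable_op A" "closable_op B" "closable_op C" "closable_op D"
    and "densely_defined (block_op A B C D)"
    and "C \<subseteq>\<^sub>o op_adjoint B"
    and "\<phi> \<in> {0..pi / 2}" "\<psi> \<in> {0..pi / 2}"
    and "\<forall>z\<in>numerical_range D. Re z \<le> \<delta>" "\<delta> < 0" "0 < \<alpha>" "\<forall>z\<in>numerical_range A. \<alpha> \<le> Re z"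
    and "numerical_range A \<subseteq> sector \<phi>" "numerical_range D \<subseteq> uminus ` sector \<psi>"
    and "(m_accretive A \<and> m_accretive (op_uminus D) \<and> rel_bounded C A \<and> rel_bounded B D) \<or>
      (m_accretive A \<and> m_accretive (op_uminus D) \<and> rel_bounded A C \<and> rel_bounded D B \<and>
        boundedly_invertible B \<and> boundedly_invertible C) \<or>
      (m_sectorial (op_uminus D) \<psi> \<and> rel_bounded B D) \<or>
      (m_sectorial A \<phi> \<and> rel_bounded C A)"
  shows "let \<tau> = max \<phi> \<psi>;
      S = (uminus ` sector \<tau> \<union> sector \<tau>) \<inter> {z. Re z \<notin> {\<delta><..<\<alpha>}}
    in approx_point_spectrum (block_op A B C D) \<subseteq> S \<and>
      (resolvent_set (block_op A B C D) \<inter> - S \<noteq> {} \<longrightarrow> op_spectrum (block_op A B C D) \<subseteq> S)"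
proof -
  define T where "T = block_op A B C D"
  define \<tau> where "\<tau> = max \<phi> \<psi>"
  define S where "S = (uminus ` sector \<tau> \<union> sector \<tau>) \<inter> {z. Re z \<notin> {\<delta><..<\<alpha>}}"
  have \<tau>: "\<tau> \<in> {0..pi / 2}"
    using assms(15,16) by (auto simp: \<tau>_def)
  then have trig: "0 \<le> sin \<tau>" "0 \<le> cos \<tau>"
    by (auto intro: sin_ge_zero cos_ge_zero)
  have mem_S: "z \<in> S \<longleftrightarrow> \<bar>Im z\<bar> * cos \<tau> \<le> \<bar>Re z\<bar> * sin \<tau> \<and> \<not> (\<delta> < Re z \<and> Re z < \<alpha>)" for z
    unfolding S_def double_sector_eq[OF \<tau>] by auto
  have linear: "linear_op T"
    unfolding T_def by (rule linear_op_block_op[OF assms(1-4)])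

  \<comment> \<open>The numerical range conditions become form estimates on the whole domain, with
    the common semi-angle \<tau> in place of \<phi>; the analogue for \<open>D\<close> carries the
    reversed signs.\<close>
  have A: "\<alpha> * (norm f)\<^sup>2 \<le> Re (cinner (op_app A f) f) \<and>
    \<bar>Im (cinner (op_app A f) f)\<bar> * cos \<tau> \<le> Re (cinner (op_app A f) f) * sin \<tau>"
    if "f \<in> op_dom A" for f
    using numerical_range_cinner[OF assms(1) that]
  proof (cases)
    case (2 z)
    have "z \<in> sector \<tau>"
      using 2 assms(21) sector_mono[of \<phi> \<tau>] by (auto simp: \<tau>_def)
    then have "\<bar>Im z\<bar> * cos \<tau> \<le> Re z * sin \<tau>" "\<alpha> \<le> Re z"
      using 2 assms(20) by (auto simp: sector_eq[OF \<tau>])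
    then have "(norm f)\<^sup>2 * (\<bar>Im z\<bar> * cos \<tau>) \<le> (norm f)\<^sup>2 * (Re z * sin \<tau>)"
      "(norm f)\<^sup>2 * \<alpha> \<le> (norm f)\<^sup>2 * Re z"
      by (auto intro: mult_left_mono)
    then show ?thesis
      unfolding 2(2) by (simp_all add: abs_mult mult_ac del: of_real_power)
  qed (simp_all add: cinner_zero_right)

  have D: "Re (cinner (op_app D g) g) \<le> \<delta> * (norm g)\<^sup>2 \<and>
    \<bar>Im (cinner (op_app D g) g)\<bar> * cos \<tau> \<le> - Re (cinner (op_app D g) g) * sin \<tau>"
    if "g \<in> op_dom D" for g
    using numerical_range_cinner[OF assms(4) that]
  proof (cases)
    case (2 z)
    have "- z \<in> sector \<tau>"
      using 2 assms(22) sector_mono[of \<psi> \<tau>] by (force simp: \<tau>_def)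
    then have "\<bar>Im z\<bar> * cos \<tau> \<le> - Re z * sin \<tau>" "Re z \<le> \<delta>"
      using 2 assms(17) by (auto simp: sector_eq[OF \<tau>])
    then have "(norm g)\<^sup>2 * (\<bar>Im z\<bar> * cos \<tau>) \<le> (norm g)\<^sup>2 * (- Re z * sin \<tau>)"
      "(norm g)\<^sup>2 * Re z \<le> (norm g)\<^sup>2 * \<delta>"
      by (intro mult_left_mono; simp)+
    then show ?thesis
      unfolding 2(2) by (simp_all add: abs_mult mult_ac del: of_real_power)
  qed (simp_all add: cinner_zero_right)

  have ap: "approx_point_spectrum T \<subseteq> S"
  proof
    fix z assume "z \<in> approx_point_spectrum T"
    then obtain x where x: "\<And>n. x n \<in> op_dom T" "\<And>n. norm (x n) = 1"
      and lim: "(\<lambda>n. op_app (op_shift T z) (x n)) \<longlonglongrightarrow> 0"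
      by (auto simp: approx_point_spectrum_def)
    \<comment> \<open>Both conditions are proved up to \<epsilon>. The minimum is nonpositive
      exactly when \<open>Re z\<close> lies outside the open interval from \<delta> to
      \<alpha>.\<close>
    have key: "\<bar>Im z\<bar> * cos \<tau> \<le> \<bar>Re z\<bar> * sin \<tau> + \<epsilon> \<and> min (\<alpha> - Re z) (Re z - \<delta>) \<le> \<epsilon>"
      if \<epsilon>: "0 < \<epsilon>" for \<epsilon>
    proof -
      \<comment> \<open>Two components of size \<epsilon>/4 give |e| <= \<epsilon>/2; the sector
        estimate uses this once for \<open>Re e\<close> and once for \<open>Im e\<close>, adding up
        to \<epsilon>.\<close>
      obtain n where n: "norm (op_app (op_shift T z) (x n)) < \<epsilon> / 4"
        using LIMSEQ_D[OF lim, of "\<epsilon> / 4"] \<epsilon> by auto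
      obtain f g where fg: "x n = (f, g)"
        by fastforce
      define h k where "h = fst (op_app (op_shift T z) (x n))"
        and "k = snd (op_app (op_shift T z) (x n))"
      define e where "e = cinner h f - cnj (cinner k g)"
      define a d where "a = cinner (op_app A f) f" and "d = cinner (op_app D g) g"
      define F G where "F = (norm f)\<^sup>2" and "G = (norm g)\<^sup>2"
      have dom: "f \<in> op_dom A" "f \<in> op_dom C" "g \<in> op_dom B" "g \<in> op_dom D"
        using x(1)[of n] by (auto simp: fg T_def block_op_def)
      have one: "F + G = 1" "0 \<le> F" "0 \<le> G"
        using x(2)[of n] by (simp_all add: fg norm_Pair F_def G_def)
      then have "(norm f)\<^sup>2 \<le> 1" "(norm g)\<^sup>2 \<le> 1"
        unfolding F_def G_def by linarith+
      then have le1: "norm f \<le> 1" "norm g \<le> 1"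
        by (simp_all add: abs_square_le_1)
      have hk: "norm h < \<epsilon> / 4" "norm k < \<epsilon> / 4"
      proof -
        have "op_app (op_shift T z) (x n) = (h, k)"
          by (simp add: h_def k_def)
        then show "norm h < \<epsilon> / 4" "norm k < \<epsilon> / 4"
          using n norm_fst_le[of h k] norm_snd_le[of k h] by auto
      qed
      have "cmod e \<le> cmod (cinner h f) + cmod (cinner k g)"
        unfolding e_def using norm_triangle_ineq4[of "cinner h f" "cnj (cinner k g)"] by simp
      also have "\<dots> \<le> norm h * norm f + norm k * norm g"
        by (intro add_mono cmod_cinner_le)
      also have "\<dots> \<le> norm h * 1 + norm k * 1"
        by (intro add_mono mult_left_mono le1) auto
      finally have e: "cmod e \<le> \<epsilon> / 2"
        using hk by simp
      then have eRI: "\<bar>Re e\<bar> \<le> \<epsilon> / 2" "\<bar>Im e\<bar> \<le> \<epsilon> / 2"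
        using abs_Re_le_cmod[of e] abs_Im_le_cmod[of e] by linarith+
      have eq: "e = a - cnj d - z * complex_of_real F + cnj z * complex_of_real G"
        unfolding e_def h_def k_def a_def d_def F_def G_def fg T_def
        by (rule block_op_coupling_cancels[OF assms(6,14) dom(2,3)])
      have Re_eq: "Re a - Re d = Re z * (F - G) + Re e"
        by (simp add: eq algebra_simps)
      have "Im a + Im d = Im z * (F + G) + Im e"
        by (simp add: eq algebra_simps)
      \<comment> \<open>Normalisation, F + G = 1, isolates \<open>Im z\<close>, whereas the real
        part only yields \<open>Re z\<close> times F - G, with |F - G| <= 1.\<close>
      with one have Im_eq: "Im z = Im a + Im d - Im e"
        by simp
      have "\<bar>Im z\<bar> * cos \<tau> \<le> (\<bar>Im a\<bar> + \<bar>Im d\<bar> + \<bar>Im e\<bar>) * cos \<tau>"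
        unfolding Im_eq by (intro mult_right_mono trig) linarith
      also have "\<dots> \<le> (Re a - Re d) * sin \<tau> + \<bar>Im e\<bar> * cos \<tau>"
        using A[OF dom(1)] D[OF dom(4)] by (simp add: a_def d_def algebra_simps)
      also have "\<dots> \<le> (\<bar>Re z\<bar> + \<bar>Re e\<bar>) * sin \<tau> + \<bar>Im e\<bar> * cos \<tau>"
      proof -
        have "Re z * (F - G) \<le> \<bar>Re z\<bar> * \<bar>F - G\<bar>"
          by (metis abs_ge_self abs_mult)
        also have "\<dots> \<le> \<bar>Re z\<bar> * 1"
          using one by (intro mult_left_mono) auto
        finally show ?thesis
          unfolding Re_eq by (intro add_right_mono mult_right_mono trig) linarith
      qed
      also have "\<dots> \<le> \<bar>Re z\<bar> * sin \<tau> + \<epsilon>"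
        using mult_mono[OF eRI(1) sin_le_one[of \<tau>]] mult_mono[OF eRI(2) cos_le_one[of \<tau>]]
          trig \<epsilon> by (simp add: distrib_right)
      finally have 1: "\<bar>Im z\<bar> * cos \<tau> \<le> \<bar>Re z\<bar> * sin \<tau> + \<epsilon>" .
      \<comment> \<open>Since F and G are convex weights, \<open>m\<close> is at most the weighted
        mean of the two distances, which the bounds \<alpha>F <= Re a and Re d <= \<delta>G compare
        with \<open>Re e\<close>.\<close>
      define m where "m = min (\<alpha> - Re z) (Re z - \<delta>)"
      have "m = m * F + m * G"
        using one(1) by (metis distrib_left mult.right_neutral)
      also have "\<dots> \<le> (\<alpha> - Re z) * F + (Re z - \<delta>) * G"
        using one by (intro add_mono mult_right_mono) (auto simp: m_def)
      also have "\<dots> \<le> (Re a - Re d) - Re z * (F - G)"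
        using A[OF dom(1)] D[OF dom(4)] by (simp add: a_def d_def F_def G_def algebra_simps)
      also have "\<dots> \<le> \<epsilon>"
        using Re_eq eRI(1) \<epsilon> by linarith
      finally show ?thesis
        using 1 by (simp add: m_def)
    qed
    then have "\<bar>Im z\<bar> * cos \<tau> \<le> \<bar>Re z\<bar> * sin \<tau>" "min (\<alpha> - Re z) (Re z - \<delta>) \<le> 0"
      by (auto intro: field_le_epsilon)
    then show "z \<in> S"
      unfolding mem_S by (auto simp: min_def split: if_splits)
  qed

  \<comment> \<open>The complement of \<open>S\<close> is the union of a convex strip containing 0
    and the complement of the double sector, which is invariant under positive dilations. Thus 0 is
    a centre, and t = 0 needs its own case.\<close>
  have "starlike (- S)"
    unfolding starlike_def
  proof (intro bexI ballI subsetI)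
    show zero: "0 \<in> - S"
      using assms(18,19) by (simp add: mem_S)
    fix z w assume z: "z \<in> - S" and "w \<in> closed_segment 0 z"
    then obtain t where t: "0 \<le> t" "t \<le> 1" "w = t *\<^sub>R z"
      by (auto simp: in_segment)
    show "w \<in> - S"
    proof (cases "t = 0")
      case True
      with t zero show ?thesis by simp
    next
      case False
      with t have "0 < t" by simp
      show ?thesis
      proof (cases "\<delta> < Re z \<and> Re z < \<alpha>")
        case True
        have "convex {u. \<delta> < Re u \<and> Re u < \<alpha>}"
          unfolding Collect_conj_eq
          by (intro convex_Int convex_halfspace_Re_gt convex_halfspace_Re_lt)
        then have "closed_segment 0 z \<subseteq> {u. \<delta> < Re u \<and> Re u < \<alpha>}"
          using True assms(18,19) by (intro closed_segment_subset) auto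
        with \<open>w \<in> closed_segment 0 z\<close> show ?thesis
          by (auto simp: mem_S)
      next
        case False
        with z have "\<bar>Re z\<bar> * sin \<tau> < \<bar>Im z\<bar> * cos \<tau>"
          by (auto simp: mem_S)
        then have "t * (\<bar>Re z\<bar> * sin \<tau>) < t * (\<bar>Im z\<bar> * cos \<tau>)"
          using \<open>0 < t\<close> by simp
        then have "\<bar>Re w\<bar> * sin \<tau> < \<bar>Im w\<bar> * cos \<tau>"
          using \<open>0 < t\<close> by (simp add: t(3) abs_mult mult.assoc)
        then show ?thesis
          by (auto simp: mem_S)
      qed
    qed
  qed
  then have "connected (- S)"
    by (rule starlike_imp_connected)
  then have "op_spectrum T \<subseteq> S" if "resolvent_set T \<inter> - S \<noteq> {}"
    using connected_subset_resolvent_set[OF linear, of "- S"] ap that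
    unfolding op_spectrum_def by blast
  with ap show ?thesis
    unfolding T_def S_def \<tau>_def Let_def by blast
qed

end
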